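(* Suppose there exists an $\mathbb{F}_q$-subspace $W$ of $V(h_1,q^n)$ of $\mathbb{F}_q$-dimension $d_2$ which is $(h_1-1,k_2)_q$-evasive. Let $U$ be an $(h_1,k_1)_q$-evasive subspace of $V=V(r,q^n)$ of $\mathbb{F}_q$-dimension $d_1$, and assume $d_2+h_1-k_2-1>k_1$. Then \[d_1\le rn-\frac{rnh_1}{d_2}.\]
   Context: $V(m,q^n)$ denotes an $m$-dimensional vector space over $\mathbb{F}_{q^n}$, viewed also as an $mn$-dimensional vector space over $\mathbb{F}_q$. For integers $h,k$, an $\mathbb{F}_q$-subspace $U$ of an $\mathbb{F}_{q^n}$-vector space $V$ is $(h,k)_q$-evasive if $\langle U\rangle_{\mathbb{F}_{q^n}}$ has $\mathbb{F}_{q^n}$-dimension at least $h$ and every $h$-dimensional $\mathbb{F}_{q^n}$-subspace of $V$ meets $U$ in an $\mathbb{F}_q$-subspace of $\mathbb{F}_q$-dimension at most $k$. *)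

theory Defs
  imports Complex_Main "HOL-Library.Cardinality"
begin

definition field_embedding :: "('k::field \<Rightarrow> 'a::field) \<Rightarrow> bool" where
  "field_embedding \<iota> \<longleftrightarrow>
     \<iota> 1 = 1 \<and> (\<forall>x y. \<iota> (x + y) = \<iota> x + \<iota> y) \<and> (\<forall>x y. \<iota> (x * y) = \<iota> x * \<iota> y)"

definition restrict_scale ::
    "('k::field \<Rightarrow> 'a::field) \<Rightarrow> ('a \<Rightarrow> 'v::ab_group_add \<Rightarrow> 'v) \<Rightarrow> 'k \<Rightarrow> 'v \<Rightarrow> 'v" where
  "restrict_scale \<iota> scale = (\<lambda>c. scale (\<iota> c))"

lemma vector_space_restrict_scale:
  assumes "field_embedding \<iota>" and "vector_space scale"
  shows "vector_space (restrict_scale \<iota> scale)"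
  using assms unfolding field_embedding_def vector_space_def restrict_scale_def by auto

text \<open>
  The whole type \<open>'v\<close> is the vector space. The finite basis is demanded explicitly because
  \<^const>\<open>vector_space.dim\<close> is also 0 on spaces of infinite dimension.
\<close>

definition vector_space_of_dim ::
    "('a::field \<Rightarrow> 'v::ab_group_add \<Rightarrow> 'v) \<Rightarrow> nat \<Rightarrow> bool" where
  "vector_space_of_dim scale m \<longleftrightarrow>
     (\<exists>B. finite_dimensional_vector_space scale B \<and> card B = m)"

text \<open>
  The parameters \<open>h\<close> and \<open>k\<close> are integers, so that \<open>h - 1\<close> is never truncated.
\<close>

definition evasive ::
    "('k::field \<Rightarrow> 'a::field) \<Rightarrow> ('a \<Rightarrow> 'v::ab_group_add \<Rightarrow> 'v) \<Rightarrow> int \<Rightarrow> int \<Rightarrow> 'v set \<Rightarrow> bool" where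
  "evasive \<iota> scale h k U \<longleftrightarrow>
     module.subspace (restrict_scale \<iota> scale) U \<and>
     int (vector_space.dim scale (module.span scale U)) \<ge> h \<and>
     (\<forall>S. module.subspace scale S \<and> int (vector_space.dim scale S) = h \<longrightarrow>
        int (vector_space.dim (restrict_scale \<iota> scale) (S \<inter> U)) \<le> k)"

end

theory Submission imports Defs "HOL-Library.FuncSet" begin

text \<open>
  Let \<open>\<F>\<close> be the field of order \<open>q\<^sup>n\<close>. Restricting an \<open>\<F>\<close>-linear map \<open>f : V(h\<^sub>1, q\<^sup>n) \<rightarrow> V\<close> to \<open>W\<close>
  and reducing modulo \<open>U\<close> gives an \<open>\<F>\<^sub>q\<close>-linear map from \<open>Hom(V(h\<^sub>1, q\<^sup>n), V)\<close>, of dimension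
  \<open>r n h\<^sub>1\<close>, to \<open>Hom(W, V/U)\<close>, of dimension \<open>d\<^sub>2 (r n - d\<^sub>1)\<close>. Its injectivity is the bound.
  If \<open>f \<noteq> 0\<close> were in its kernel, enlarge the kernel of \<open>f\<close> by vectors of \<open>W\<close> to dimension
  \<open>h\<^sub>1 - 1\<close> and the range of \<open>f\<close> by vectors of \<open>U\<close> to dimension \<open>h\<^sub>1\<close>; every added vector
  enlarges the intersection with \<open>W\<close>, respectively \<open>U\<close>, so that rank-nullity over both fields
  contradicts the two evasiveness bounds.
\<close>

text \<open>Turns dimensions into exponents, so that the final inequality can be read off from
  cardinalities. A new basis vector \<open>b\<close> multiplies the size by \<open>CARD('a)\<close>,
  because its coefficient is unique when \<open>b\<close> is outside the old span.\<close>

lemma (in vector_space) span_finite_card: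
  assumes "finite (UNIV :: 'a set)" "finite B" "independent B"
  shows "finite (span B) \<and> card (span B) = CARD('a) ^ card B"
  using assms(2,3)
proof (induction B rule: finite_induct)
  case empty
  then show ?case by simp
next
  case (insert b B)
  have ind: "independent B" "b \<notin> span B"
    using insert.prems insert.hyps(2) by (auto simp: independent_insert)
  have eq: "span (insert b B) = (\<lambda>(c, x). scale c b + x) ` (UNIV \<times> span B)" (is "_ = ?f ` _")
  proof (intro set_eqI iffI)
    fix x assume "x \<in> span (insert b B)"
    then obtain c where "x - scale c b \<in> span B" by (auto simp: span_breakdown_eq)
    then have "(c, x - scale c b) \<in> UNIV \<times> span B" "x = ?f (c, x - scale c b)" by auto
    then show "x \<in> ?f ` (UNIV \<times> span B)" by blast
  next
    fix x assume "x \<in> ?f ` (UNIV \<times> span B)"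
    then obtain c y where "y \<in> span B" "x = scale c b + y" by auto
    then show "x \<in> span (insert b B)"
      unfolding span_breakdown_eq by (intro exI[of _ c]) simp
  qed
  have "inj_on ?f (UNIV \<times> span B)"
  proof (rule inj_onI, clarify)
    fix c x d y
    assume x: "x \<in> span B" and y: "y \<in> span B" and e: "scale c b + x = scale d b + y"
    have "scale (c - d) b = y - x" using e by (simp add: scale_left_diff_distrib algebra_simps)
    then have s: "scale (c - d) b \<in> span B" using x y by (simp add: span_diff)
    have "c = d"
    proof (rule ccontr)
      assume "c \<noteq> d"
      with span_scale[OF s, of "inverse (c - d)"] ind(2) show False by simp
    qed
    with e show "c = d \<and> x = y" by simp
  qed
  then show ?case
    using insert.IH[OF ind(1)] insert.hyps assms(1)
    by (simp add: eq card_image card_cartesian_product)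
qed

lemma (in finite_dimensional_vector_space) card_subspace:
  assumes "finite (UNIV :: 'a set)" "subspace S"
  shows "finite S \<and> card S = CARD('a) ^ dim S"
proof -
  obtain B where B: "B \<subseteq> S" "independent B" "S \<subseteq> span B" "card B = dim S"
    by (rule basis_exists)
  have "span B = S" using B assms(2) span_subspace by blast
  then show ?thesis using span_finite_card[OF assms(1) finiteI_independent[OF B(2)] B(2)] B(4)
    by simp
qed

lemma (in vector_space) finite_dimensional_if_finite_UNIV:
  assumes "finite (UNIV :: 'b set)"
  shows "\<exists>B. finite_dimensional_vector_space scale B"
proof -
  obtain B where "independent B" "UNIV \<subseteq> span B" using basis_exists[of UNIV] by metis
  then have "finite_dimensional_vector_space scale B"
    using finite_subset[OF subset_UNIV assms] by unfold_locales auto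
  then show ?thesis ..
qed

text \<open>Rank-nullity on a subspace by counting: \<open>S\<close> has as many elements as image
  times kernel, and comparing exponents of \<open>CARD('a)\<close> gives the sum of
  dimensions.\<close>

lemma (in finite_dimensional_vector_space_pair) dim_kernel_image:
  assumes fin: "finite (UNIV :: 'a set)" and f: "Vector_Spaces.linear s1 s2 f" and S: "vs1.subspace S"
  shows "vs1.dim S = vs1.dim (S \<inter> {x. f x = 0}) + vs2.dim (f ` S)"
proof -
  interpret f: Vector_Spaces.linear s1 s2 f by fact
  define K where "K = S \<inter> {x. f x = 0}"
  have subK: "vs1.subspace K"
    unfolding K_def by (intro vs1.subspace_inter S f.subspace_kernel)
  have subI: "vs2.subspace (f ` S)" using f.subspace_image[OF S] .
  define g where "g = inv_into S f"
  have g: "g y \<in> S" "f (g y) = y" if "y \<in> f ` S" for y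
    using that by (simp_all add: g_def inv_into_into f_inv_into_f)
  \<comment> \<open>\<open>g\<close> is a section of \<open>f\<close> that need not be linear; it
    picks a representative of each fibre, and the fibre is that representative plus
    \<open>K\<close>.\<close>
  have "bij_betw (\<lambda>(y, z). g y + z) (f ` S \<times> K) S"
    by (rule bij_betw_byWitness[where f' = "\<lambda>x. (f x, x - g (f x))"])
      (use g S in \<open>auto simp: K_def f.add f.diff vs1.subspace_add vs1.subspace_diff\<close>)
  then have "card S = card (f ` S) * card K"
    by (metis bij_betw_same_card card_cartesian_product)
  moreover have "CARD('a) > 1"
  proof -
    have "card {0, 1 :: 'a} \<le> CARD('a)" by (intro card_mono fin) auto
    then show ?thesis by simp
  qed
  ultimately show ?thesis
    using vs1.card_subspace[OF fin S] vs1.card_subspace[OF fin subK]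
      vs2.card_subspace[OF fin subI]
    by (simp add: K_def flip: power_add)
qed

text \<open>While \<open>K\<close> has dimension below \<open>h\<close> it cannot contain
  \<open>U\<close>, whose span is too large. Adjoining a vector of \<open>U\<close> outside
  \<open>K\<close> raises the dimension of \<open>K\<close> by exactly one and that of
  \<open>K \<inter> U\<close> by at least one. At dimension \<open>h\<close> evasiveness bounds the
  intersection.\<close>

lemma evasive_extend_subspace:
  fixes \<iota> :: "'k::field \<Rightarrow> 'a::field" and scale :: "'a \<Rightarrow> 'v::ab_group_add \<Rightarrow> 'v"
  assumes "finite_dimensional_vector_space scale B"
    and "finite_dimensional_vector_space (restrict_scale \<iota> scale) C"
    and ev: "evasive \<iota> scale h k U"
    and K: "module.subspace scale K" "int (vector_space.dim scale K) \<le> h"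
  shows "int (vector_space.dim (restrict_scale \<iota> scale) (K \<inter> U)) + (h - int (vector_space.dim scale K)) \<le> k"
proof -
  interpret F: finite_dimensional_vector_space scale B by fact
  interpret Q: finite_dimensional_vector_space "restrict_scale \<iota> scale" C by fact
  have U: "Q.subspace U" "h \<le> int (F.dim (F.span U))"
    and meet: "\<And>S. F.subspace S \<Longrightarrow> int (F.dim S) = h \<Longrightarrow> int (Q.dim (S \<inter> U)) \<le> k"
    using ev by (auto simp: evasive_def)
  have restr: "Q.subspace S" if "F.subspace S" for S
    using that unfolding Q.subspace_def F.subspace_def by (simp add: restrict_scale_def)
  show ?thesis
    using K
  proof (induction "nat (h - int (F.dim K))" arbitrary: K)
    case 0
    then show ?case using meet by simp
  next
    case (Suc m)
    have "\<not> U \<subseteq> K"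
    proof
      assume "U \<subseteq> K"
      then have "F.dim (F.span U) \<le> F.dim K"
        using F.dim_subset F.span_minimal Suc.prems(1) by metis
      with U(2) Suc.hyps(2) show False by linarith
    qed
    then obtain u where u: "u \<in> U" "u \<notin> K" by blast
    let ?L = "F.span (insert u K)"
    have KL: "K \<subseteq> ?L" "u \<in> ?L" by (auto intro: F.span_base)
    have dimL: "F.dim ?L = F.dim K + 1"
      using u(2) Suc.prems(1) by (simp add: F.dim_insert F.span_eq_iff[THEN iffD2])
    have subs: "Q.span (K \<inter> U) = K \<inter> U" "Q.span (?L \<inter> U) = ?L \<inter> U"
      using Q.subspace_inter[OF restr U(1)] Suc.prems(1) by (simp_all add: Q.span_eq_iff)
    \<comment> \<open>\<open>Q.dim_psubset\<close> compares spans, hence \<open>subs\<close>; the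
      vector \<open>u\<close> makes the inclusion strict.\<close>
    have "Q.dim (K \<inter> U) < Q.dim (?L \<inter> U)"
      by (rule Q.dim_psubset) (use KL u in \<open>auto simp: subs\<close>)
    moreover have "int (Q.dim (?L \<inter> U)) + (h - int (F.dim ?L)) \<le> k"
      using Suc.hyps(2) dimL by (intro Suc.hyps(1)) auto
    ultimately show ?case using dimL by simp
  qed
qed

text \<open>For nonzero \<open>f\<close>, add the extension bounds for its kernel in
  \<open>W\<close> and its range in \<open>U\<close>. By rank-nullity the left sides total at least
  \<open>dim W + card BW - 1\<close>, so \<open>k\<^sub>1 + k\<^sub>2\<close> is at least that,
  against \<open>less\<close>.\<close>

lemma evasive_pair_no_map:
  fixes \<iota> :: "'k::{field,finite} \<Rightarrow> 'a::{field,finite}"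
    and scaleV :: "'a \<Rightarrow> 'v::ab_group_add \<Rightarrow> 'v"
    and scaleW :: "'a \<Rightarrow> 'w::ab_group_add \<Rightarrow> 'w"
  assumes W: "finite_dimensional_vector_space scaleW BW"
      "finite_dimensional_vector_space (restrict_scale \<iota> scaleW) CW"
    and V: "finite_dimensional_vector_space scaleV BV"
      "finite_dimensional_vector_space (restrict_scale \<iota> scaleV) CV"
    and evW: "evasive \<iota> scaleW (int (card BW) - 1) k\<^sub>2 W"
    and evU: "evasive \<iota> scaleV (int (card BW)) k\<^sub>1 U"
    and less: "k\<^sub>1 < int (vector_space.dim (restrict_scale \<iota> scaleW) W) + int (card BW) - k\<^sub>2 - 1"
    and f: "Vector_Spaces.linear scaleW scaleV f" "f ` W \<subseteq> U"
  shows "f x = 0"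
proof (rule ccontr)
  assume nz: "f x \<noteq> 0"
  interpret F: finite_dimensional_vector_space_pair scaleW BW scaleV BV
    using W(1) V(1) by (simp add: finite_dimensional_vector_space_pair_def)
  interpret Q: finite_dimensional_vector_space_pair
    "restrict_scale \<iota> scaleW" CW "restrict_scale \<iota> scaleV" CV
    using W(2) V(2) by (simp add: finite_dimensional_vector_space_pair_def)
  interpret f: Vector_Spaces.linear scaleW scaleV f by fact
  have fQ: "Vector_Spaces.linear (restrict_scale \<iota> scaleW) (restrict_scale \<iota> scaleV) f"
    by unfold_locales (auto simp: f.add f.scale restrict_scale_def)
  have subW: "Q.vs1.subspace W" and subU: "Q.vs2.subspace U"
    using evW evU by (auto simp: evasive_def)
  define K where "K = {x. f x = 0}"
  define I where "I = range f"
  have subs: "F.vs1.subspace K" "F.vs2.subspace I"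
    using f.subspace_kernel f.subspace_image[OF F.vs1.subspace_UNIV] by (simp_all add: K_def I_def)
  have rankF: "card BW = F.vs1.dim K + F.vs2.dim I"
    using F.dim_kernel_image[OF _ f(1) F.vs1.subspace_UNIV] by (simp add: K_def I_def)
  have rankQ: "Q.vs1.dim W = Q.vs1.dim (K \<inter> W) + Q.vs2.dim (f ` W)"
    using Q.dim_kernel_image[OF _ fQ subW] by (simp add: K_def Int_commute)
  \<comment> \<open>A nonzero range leaves the kernel dimension at most \<open>card BW - 1\<close>,
    which is what allows the kernel to be extended to that dimension.\<close>
  have "F.vs2.dim I \<noteq> 0" using nz by (auto simp: I_def)
  then have "int (Q.vs1.dim (K \<inter> W)) + (int (card BW) - 1 - int (F.vs1.dim K)) \<le> k\<^sub>2"
    using rankF by (intro evasive_extend_subspace[OF W evW subs(1)]) linarith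
  moreover have "int (Q.vs2.dim (I \<inter> U)) + (int (card BW) - int (F.vs2.dim I)) \<le> k\<^sub>1"
    using rankF by (intro evasive_extend_subspace[OF V evU subs(2)]) linarith
  moreover have "Q.vs2.dim (f ` W) \<le> Q.vs2.dim (I \<inter> U)"
    using f(2) by (intro Q.vs2.dim_subset) (auto simp: I_def)
  ultimately show False using rankF rankQ less by linarith
qed

theorem theorem4p8:
  fixes \<iota> :: "'k::{field,finite} \<Rightarrow> 'a::{field,finite}"
    and scaleV :: "'a \<Rightarrow> 'v::ab_group_add \<Rightarrow> 'v"
    and scaleW :: "'a \<Rightarrow> 'w::ab_group_add \<Rightarrow> 'w"
    and U :: "'v set"
    and q n r h\<^sub>1 d\<^sub>1 d\<^sub>2 :: nat
    and k\<^sub>1 k\<^sub>2 :: int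
  assumes "field_embedding \<iota>" and "CARD('k) = q" and "CARD('a) = q ^ n"
    and "vector_space_of_dim scaleW h\<^sub>1"
    and "\<exists>W. evasive \<iota> scaleW (int h\<^sub>1 - 1) k\<^sub>2 W \<and>
             vector_space.dim (restrict_scale \<iota> scaleW) W = d\<^sub>2"
    and "vector_space_of_dim scaleV r"
    and "evasive \<iota> scaleV (int h\<^sub>1) k\<^sub>1 U"
    and "vector_space.dim (restrict_scale \<iota> scaleV) U = d\<^sub>1"
    and "int d\<^sub>2 + int h\<^sub>1 - k\<^sub>2 - 1 > k\<^sub>1"
  shows "real d\<^sub>1 \<le> real r * real n - real r * real n * real h\<^sub>1 / real d\<^sub>2"
proof -
  obtain BW where W: "finite_dimensional_vector_space scaleW BW" and cBW: "card BW = h\<^sub>1"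
    using assms(4) by (auto simp: vector_space_of_dim_def)
  obtain BV where V: "finite_dimensional_vector_space scaleV BV" and cBV: "card BV = r"
    using assms(6) by (auto simp: vector_space_of_dim_def)
  interpret F: finite_dimensional_vector_space_pair scaleW BW scaleV BV
    using W V by (simp add: finite_dimensional_vector_space_pair_def)
  have cardV: "finite (UNIV :: 'v set)" "CARD('v) = q ^ (n * r)"
    using F.vs2.card_subspace[OF _ F.vs2.subspace_UNIV]
    by (simp_all add: cBV assms(3) power_mult)
  have finW: "finite (UNIV :: 'w set)"
    using F.vs1.card_subspace[OF _ F.vs1.subspace_UNIV] by simp
  \<comment> \<open>Finiteness of the underlying sets yields bases over the small field.\<close>
  obtain CW where WQ: "finite_dimensional_vector_space (restrict_scale \<iota> scaleW) CW"
    using vector_space.finite_dimensional_if_finite_UNIV[OF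
        vector_space_restrict_scale[OF assms(1) F.vs1.vector_space_axioms] finW] ..
  obtain CV where VQ: "finite_dimensional_vector_space (restrict_scale \<iota> scaleV) CV"
    using vector_space.finite_dimensional_if_finite_UNIV[OF
        vector_space_restrict_scale[OF assms(1) F.vs2.vector_space_axioms] cardV(1)] ..
  interpret Q: finite_dimensional_vector_space_pair
    "restrict_scale \<iota> scaleW" CW "restrict_scale \<iota> scaleV" CV
    using WQ VQ by (simp add: finite_dimensional_vector_space_pair_def)
  obtain W where evW: "evasive \<iota> scaleW (int h\<^sub>1 - 1) k\<^sub>2 W" and dW: "Q.vs1.dim W = d\<^sub>2"
    using assms(5) by blast
  have subU: "Q.vs2.subspace U" and subW: "Q.vs1.subspace W"
    using evW assms(7) by (auto simp: evasive_def)
  have cardU: "finite U" "card U = q ^ d\<^sub>1"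
    using Q.vs2.card_subspace[OF _ subU] by (simp_all add: assms(2,8))
  have q: "q > 1"
  proof -
    have "card {0, 1 :: 'k} \<le> CARD('k)" by (intro card_mono) auto
    then show ?thesis by (simp add: assms(2))
  qed
  obtain C where C: "C \<subseteq> W" "Q.vs1.independent C" "W \<subseteq> Q.vs1.span C" "card C = d\<^sub>2"
    using Q.vs1.basis_exists dW by metis
  have finC: "finite C" and finBW: "finite BW"
    using finite_subset[OF subset_UNIV finW] by auto
  have lin: "Vector_Spaces.linear scaleW scaleV (F.construct BW g)" for g
    by (rule F.linear_construct) (rule F.vs1.independent_Basis)
  \<comment> \<open>Injectivity into \<open>Hom(W, V/U)\<close>, with the cosets of \<open>U\<close> replaced by a summand \<open>u c \<in> U\<close>
    at each basis vector \<open>c\<close> of \<open>W\<close>.\<close>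
  define \<Phi> where "\<Phi> = (\<lambda>(g, u). \<lambda>c\<in>C. F.construct BW g c + u c)"
  have "inj_on \<Phi> ((BW \<rightarrow>\<^sub>E UNIV) \<times> (C \<rightarrow>\<^sub>E U))"
  proof (rule inj_onI, clarify)
    fix g u g' u'
    assume g: "g \<in> BW \<rightarrow>\<^sub>E UNIV" "g' \<in> BW \<rightarrow>\<^sub>E UNIV"
      and u: "u \<in> C \<rightarrow>\<^sub>E U" "u' \<in> C \<rightarrow>\<^sub>E U" and eq: "\<Phi> (g, u) = \<Phi> (g', u')"
    define f where "f x = F.construct BW g x - F.construct BW g' x" for x
    have linf: "Vector_Spaces.linear scaleW scaleV f"
      unfolding f_def by (intro F.linear_compose_sub lin)
    then interpret f: Vector_Spaces.linear scaleW scaleV f .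
    have fQ: "module_hom (restrict_scale \<iota> scaleW) (restrict_scale \<iota> scaleV) f"
      by unfold_locales (auto simp: f.add f.scale restrict_scale_def)
    have eqC: "F.construct BW g c + u c = F.construct BW g' c + u' c" if "c \<in> C" for c
      using fun_cong[OF eq, of c] that by (simp add: \<Phi>_def)
    \<comment> \<open>Equal values of \<open>\<Phi>\<close> mean that both maps agree modulo
      \<open>U\<close> on \<open>C\<close>, so their difference \<open>f\<close> sends the span of
      \<open>C\<close> over the small field, and hence \<open>W\<close>, into
      \<open>U\<close>.\<close>
    have "f c = u' c - u c" if "c \<in> C" for c
      using eqC[OF that] by (simp add: f_def algebra_simps)
    then have "f ` C \<subseteq> U" using PiE_mem[OF u(1)] PiE_mem[OF u(2)] Q.vs2.subspace_diff[OF subU] by (metis image_subsetI)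
    then have "f ` W \<subseteq> U"
      using module_hom.spans_image[OF fQ C(3)] Q.vs2.span_minimal[OF _ subU] by blast
    then have "f x = 0" for x
      using evW assms(7,9) dW
      by (intro evasive_pair_no_map[OF W WQ V VQ _ _ _ linf]) (auto simp: cBW)
    then have same: "F.construct BW g x = F.construct BW g' x" for x by (simp add: f_def)
    have "g b = g' b" if "b \<in> BW" for b
      using same[of b] F.construct_basis[OF F.vs1.independent_Basis that] by simp
    moreover have "u c = u' c" if "c \<in> C" for c using eqC[OF that] same by simp
    ultimately show "g = g' \<and> u = u'" using g u by (blast intro: PiE_ext)
  qed
  moreover have "\<Phi> ` ((BW \<rightarrow>\<^sub>E UNIV) \<times> (C \<rightarrow>\<^sub>E U)) \<subseteq> C \<rightarrow>\<^sub>E UNIV"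
    by (auto simp: \<Phi>_def)
  ultimately have "card ((BW \<rightarrow>\<^sub>E (UNIV :: 'v set)) \<times> (C \<rightarrow>\<^sub>E U)) \<le> card (C \<rightarrow>\<^sub>E (UNIV :: 'v set))"
    using finC cardV(1) by (intro card_inj_on_le[of \<Phi>]) (auto intro: finite_PiE)
  \<comment> \<open>There are \<open>q ^ (n * r)\<close> values for \<open>g\<close> at each of
    \<open>h\<^sub>1\<close> basis vectors, and \<open>q ^ d\<^sub>1\<close> values for
    \<open>u\<close> at each of \<open>d\<^sub>2\<close> vectors of \<open>C\<close>.\<close>
  then have "q ^ (n * r * h\<^sub>1 + d\<^sub>1 * d\<^sub>2) \<le> q ^ (n * r * d\<^sub>2)"
    using finC finBW
    by (simp add: card_cartesian_product card_PiE cardU cardV C(4) cBW power_add power_mult)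
  then have "n * r * h\<^sub>1 + d\<^sub>1 * d\<^sub>2 \<le> n * r * d\<^sub>2" using q by simp
  then have main: "real n * real r * real h\<^sub>1 + real d\<^sub>1 * real d\<^sub>2 \<le> real n * real r * real d\<^sub>2"
    by (simp flip: of_nat_mult of_nat_add)
  \<comment> \<open>Prepares the case \<open>d\<^sub>2 = 0\<close>: division by zero gives 0, so the
    claim there reads \<open>d\<^sub>1 \<le> r * n\<close>.\<close>
  have "q ^ d\<^sub>1 \<le> q ^ (n * r)" using card_mono[OF cardV(1), of U] cardU(2) cardV(2) by simp
  then have le: "d\<^sub>1 \<le> n * r" using q by simp
  show ?thesis
  proof (cases "d\<^sub>2 = 0")
    case True
    then show ?thesis using le by (simp add: mult.commute flip: of_nat_mult)
  next
    case False
    then show ?thesis using main by (simp add: field_simps)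
  qed
qed

end
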